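(* Let $n\ge 0$ be an integer. Then $F(4,n)$ is divisible by $4$, unless $n$ is of the form $\frac{2^{2t}-1}{3}$ with $t\ge 0$ an integer, in which case $F(4,n)\equiv 1\pmod 4$, or of the form $\frac{2^{2t+1}+2^{2j+1}-1}{3}$ with integers $t>j\ge 0$, in which case $F(4,n)\equiv 2\pmod 4$.
   Context: For integers $s\ge 1$ and $n\ge 0$, the $s$-Catalan number is the integer $F(s,n)=\frac{1}{(s-1)n+1}\binom{sn}{n}$; in particular $F(4,n)=\frac{1}{3n+1}\binom{4n}{n}$. *)

theory Defs
  imports Complex_Main "HOL-Number_Theory.Cong"
begin

text \<open>The \<open>s\<close>-Catalan number, meant for \<open>s \<ge> 1\<close>. The division is exact
  (\<open>s_catalan_dvd\<close>), so this is the usual quotient (\<open>s_catalan_eq\<close>).\<close>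

definition s_catalan :: "nat \<Rightarrow> nat \<Rightarrow> nat" where
  "s_catalan s n = ((s * n) choose n) div ((s - 1) * n + 1)"

lemma s_catalan_dvd:
  assumes "s \<ge> 1"
  shows "(s - 1) * n + 1 dvd (s * n) choose n"
proof -
  obtain r where s: "s = Suc r"
    using assms by (cases s) auto
  have cop: "coprime (r * n + 1) (s * n + 1)"
  proof (rule coprimeI)
    fix d assume d: "d dvd r * n + 1" "d dvd s * n + 1"
    have "s * n + 1 - (r * n + 1) = n"
      by (simp add: s)
    then have "d dvd n"
      using dvd_diff_nat[OF d(2,1)] by simp
    then have "d dvd r * n"
      by (rule dvd_mult)
    then show "d dvd 1"
      using d(1) dvd_add_right_iff by blast
  qed
  have "Suc (s * n) - n = r * n + 1"
    by (simp add: s)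
  then have "(r * n + 1) * (Suc (s * n) choose n) = (s * n + 1) * ((s * n) choose n)"
    using binomial_absorb_comp[of "Suc (s * n)" n] by simp
  then have "r * n + 1 dvd (s * n + 1) * ((s * n) choose n)"
    by (metis dvd_triv_left)
  then have "r * n + 1 dvd (s * n) choose n"
    using cop coprime_dvd_mult_right_iff by blast
  then show ?thesis
    by (simp add: s)
qed

lemma s_catalan_eq:
  assumes "s \<ge> 1"
  shows "real (s_catalan s n) = 1 / ((real s - 1) * real n + 1) * real ((s * n) choose n)"
proof -
  have "real ((s - 1) * n + 1) = (real s - 1) * real n + 1"
    using assms by (simp add: of_nat_diff)
  then show ?thesis
    using s_catalan_dvd[OF assms, of n] unfolding s_catalan_def
    by (simp add: real_of_nat_div)
qed

end

theory Submission
  imports Defs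
begin

text \<open>Let \<open>D k\<close> (below: \<open>odd_prod\<close>) be \<open>1 \<cdot> 3 \<cdot> \<dots> \<cdot> (2 k - 1)\<close>. Splitting a factorial into its even and odd factors
  gives \<open>(2 k)! = 2\<^sup>k k! D k\<close> (\<open>fact_double\<close>). Applied twice to \<open>(4 n)!\<close>, this cancels \<open>n!\<close> from
  \<open>F(4,n) = (4 n)! / (n! (3 n + 1)!)\<close> and leaves
  \<open>F(4,n) (3 n + 1)! = 2\<^bsup>3 n\<^esup> D (2 n) D n\<close>, where the last two factors are odd
  (\<open>s_catalan_4_fact\<close>).
  By Legendre's formula the exponent of \<open>2\<close> in \<open>m!\<close> is \<open>m\<close> minus the binary digit sum of \<open>m\<close>
  (\<open>fact_bit_sum\<close>), so the exponent of \<open>2\<close> in \<open>F(4,n)\<close> is one less than the binary digit sum of \<open>3 n + 1\<close>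
  (\<open>s_catalan_4_odd_multiple\<close>).

  Hence \<open>F(4,n)\<close> is odd iff \<open>3 n + 1\<close> is a power of \<open>2\<close>, and it is \<open>2\<close> modulo \<open>4\<close> iff
  \<open>3 n + 1\<close> is a sum of two distinct powers of \<open>2\<close>. As \<open>2\<^sup>a\<close> is \<open>1\<close> or \<open>2\<close> modulo \<open>3\<close>
  according to the parity of \<open>a\<close>, and \<open>3 n + 1\<close> is \<open>1\<close>, the exponent is even in the first case,
  and both exponents are odd in the second. This settles all but the residue
  when \<open>3 n + 1 = 4\<^sup>t\<close>. There both sides are compared modulo \<open>4\<close>: the odd part of \<open>(2\<^sup>k)!\<close> is
  \<open>3\<close> for \<open>k \<ge> 2\<close> (\<open>fact_power_2\<close>), while \<open>n\<close> is \<open>1\<close> modulo \<open>4\<close> (for \<open>t > 0\<close>), so that \<open>D n\<close> is \<open>1\<close> and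
  \<open>D (2 n)\<close> is \<open>3\<close>; the quotient is \<open>1\<close>.\<close>

section \<open>Odd double factorials\<close>

definition odd_prod :: "nat \<Rightarrow> nat" where
  "odd_prod k = (\<Prod>i<k. 2 * i + 1)"

lemma odd_prod_0 [simp]: "odd_prod 0 = 1"
  by (simp add: odd_prod_def)

lemma odd_prod_Suc [simp]: "odd_prod (Suc k) = odd_prod k * (2 * k + 1)"
  by (simp add: odd_prod_def)

lemma odd_odd_prod: "odd (odd_prod k)"
  by (induction k) auto

lemma fact_double: "fact (2 * k) = 2 ^ k * fact k * odd_prod k"
proof (induction k)
  case (Suc k)
  have "fact (2 * Suc k) = (2 * k + 2) * (2 * k + 1) * (fact (2 * k) :: nat)"
    by (simp add: algebra_simps)
  then show ?case
    by (simp only: Suc.IH) (simp add: algebra_simps)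
qed simp

text \<open>Four consecutive odd numbers represent each of \<open>1\<close> and \<open>3\<close> modulo \<open>4\<close> twice, so
  their product is \<open>1\<close>.\<close>

lemma odd_prod_add_4: "[odd_prod (k + 4) = odd_prod k] (mod 4)"
proof -
  have "[(2 * k + 1) * (2 * k + 3) * ((2 * k + 5) * (2 * k + 7)) = 1] (mod 4)"
  proof -
    have "(2 * k + 1) * (2 * k + 3) * ((2 * k + 5) * (2 * k + 7)) =
        1 + 4 * (4 * k ^ 4 + 32 * k ^ 3 + 86 * k\<^sup>2 + 88 * k + 26)"
      by (simp add: algebra_simps power2_eq_square power3_eq_cube power4_eq_xxxx)
    then show ?thesis
      by (simp only: cong_def mod_mult_self2)
  qed
  then have "[odd_prod k * ((2 * k + 1) * (2 * k + 3) * ((2 * k + 5) * (2 * k + 7))) =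
      odd_prod k * 1] (mod 4)"
    by (intro cong_mult cong_refl)
  moreover have "odd_prod (k + 4) =
      odd_prod k * ((2 * k + 1) * (2 * k + 3) * ((2 * k + 5) * (2 * k + 7)))"
  proof -
    have "k + 4 = Suc (Suc (Suc (Suc k)))"
      by simp
    then show ?thesis
      by (simp only: odd_prod_Suc) (simp add: algebra_simps)
  qed
  ultimately show ?thesis
    by simp
qed

lemma odd_prod_mod_4: "[odd_prod (4 * q + r) = odd_prod r] (mod 4)"
proof (induction q)
  case (Suc q)
  have "4 * Suc q + r = 4 * q + r + 4"
    by simp
  then show ?case
    using cong_trans[OF odd_prod_add_4 Suc.IH] by (simp only:)
qed simp

section \<open>The binary digit sum and the power of two in a factorial\<close>

fun bit_sum :: "nat \<Rightarrow> nat" where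
  "bit_sum n = (if n = 0 then 0 else n mod 2 + bit_sum (n div 2))"

declare bit_sum.simps [simp del]

lemma bit_sum_0 [simp]: "bit_sum 0 = 0"
  by (simp add: bit_sum.simps)

lemma bit_sum_double [simp]: "bit_sum (2 * k) = bit_sum k"
  by (cases "k = 0") (simp_all add: bit_sum.simps[of "2 * k"])

lemma bit_sum_Suc_double [simp]: "bit_sum (Suc (2 * k)) = Suc (bit_sum k)"
  by (simp add: bit_sum.simps[of "Suc (2 * k)"])

lemma binary_induct [case_names zero even odd]:
  assumes "P 0" "\<And>k. k > 0 \<Longrightarrow> P k \<Longrightarrow> P (2 * k)" "\<And>k. P k \<Longrightarrow> P (Suc (2 * k))"
  shows "P (n :: nat)"
proof (induction n rule: less_induct)
  case (less n)
  define k where "k = n div 2"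
  then consider "n = 0" | "k > 0" "n = 2 * k" | "n = Suc (2 * k)"
    by linarith
  then show ?case
    using less.IH[of k] assms by cases auto
qed

lemma bit_sum_eq_0: "bit_sum n = 0 \<longleftrightarrow> n = 0"
  by (induction n rule: binary_induct) auto

lemma bit_sum_power: "bit_sum (2 ^ a) = 1"
  by (induction a) (use bit_sum_Suc_double[of 0] in simp_all)

lemma bit_sum_eq_1D: "bit_sum n = 1 \<Longrightarrow> \<exists>a. n = 2 ^ a"
proof (induction n rule: binary_induct)
  case (even k)
  then obtain a where "k = 2 ^ a"
    by auto
  then have "2 * k = 2 ^ Suc a"
    by simp
  then show ?case
    by blast
next
  case (odd k)
  then have "Suc (2 * k) = 2 ^ 0"
    by (simp add: bit_sum_eq_0)
  then show ?case
    by blast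
qed simp

lemma bit_sum_two_powers: "b < a \<Longrightarrow> bit_sum (2 ^ a + 2 ^ b) = 2"
proof (induction b arbitrary: a)
  case 0
  then obtain c where "a = Suc c"
    by (cases a) auto
  then show ?case
    by (simp add: bit_sum_power)
next
  case (Suc b)
  then obtain c where c: "a = Suc c" "b < c"
    by (cases a) auto
  then have "(2::nat) ^ a + 2 ^ Suc b = 2 * (2 ^ c + 2 ^ b)"
    by simp
  then show ?case
    using Suc.IH[OF c(2)] by (simp only: bit_sum_double)
qed

lemma bit_sum_eq_2D: "bit_sum n = 2 \<Longrightarrow> \<exists>a b. b < a \<and> n = 2 ^ a + 2 ^ b"
proof (induction n rule: binary_induct)
  case (even k)
  then obtain a b where "b < a" "k = 2 ^ a + 2 ^ b"
    by auto
  then have "Suc b < Suc a" "2 * k = 2 ^ Suc a + 2 ^ Suc b"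
    by simp_all
  then show ?case
    by blast
next
  case (odd k)
  then obtain a where "k = 2 ^ a"
    using bit_sum_eq_1D[of k] by auto
  then have "Suc (2 * k) = 2 ^ Suc a + 2 ^ 0"
    by simp
  then show ?case
    by (intro exI[of _ "Suc a"] exI[of _ 0]) simp
qed simp

text \<open>Legendre's formula for the prime \<open>2\<close>, in a form without subtraction or division. Doubling
  \<open>k\<close> leaves the digit sum unchanged and multiplies \<open>k!\<close> by \<open>2\<^sup>k\<close> and an odd number; going on
  to \<open>2 k + 1\<close> adds one digit \<open>1\<close> and an odd factor.\<close>

lemma fact_bit_sum: "\<exists>u. odd u \<and> fact m * 2 ^ bit_sum m = 2 ^ m * (u :: nat)"
proof (induction m rule: binary_induct)
  case zero
  show ?case
    by (intro exI[of _ 1]) simp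
next
  case (even k)
  then obtain u where u: "odd u" "fact k * 2 ^ bit_sum k = 2 ^ k * (u :: nat)"
    by blast
  have "fact (2 * k) * 2 ^ bit_sum (2 * k) =
      2 ^ k * (fact k * 2 ^ bit_sum k) * odd_prod k"
    by (simp add: fact_double)
  also have "\<dots> = 2 ^ (2 * k) * (u * odd_prod k)"
    by (simp add: u(2) mult_2 power_add)
  finally show ?case
    using u(1) odd_odd_prod[of k] by (intro exI[of _ "u * odd_prod k"]) simp
next
  case (odd k)
  then obtain u where u: "odd u" "fact k * 2 ^ bit_sum k = 2 ^ k * (u :: nat)"
    by blast
  have "fact (Suc (2 * k)) * 2 ^ bit_sum (Suc (2 * k)) =
      Suc (2 * k) * 2 * 2 ^ k * (fact k * 2 ^ bit_sum k) * odd_prod k"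
    unfolding fact_Suc fact_double bit_sum_Suc_double power_Suc of_nat_id
    by (simp only: mult_ac)
  also have "\<dots> = Suc (2 * k) * 2 * (2 ^ k * 2 ^ k) * (u * odd_prod k)"
    unfolding u(2) by (simp only: mult_ac)
  also have "2 ^ k * 2 ^ k = (2::nat) ^ (2 * k)"
    by (simp add: mult_2 power_add)
  also have "Suc (2 * k) * 2 * 2 ^ (2 * k) * (u * odd_prod k) =
      2 ^ Suc (2 * k) * (Suc (2 * k) * u * odd_prod k)"
    by (simp only: power_Suc mult_ac)
  finally show ?case
    using u(1) odd_odd_prod[of k] by (intro exI[of _ "Suc (2 * k) * u * odd_prod k"]) simp
qed

text \<open>Doubling the argument from \<open>2\<^sup>k\<close> on multiplies the odd part by \<open>odd_prod (2 ^ k)\<close>, which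
  is \<open>1\<close> modulo \<open>4\<close> once \<open>4\<close> divides \<open>2\<^sup>k\<close>; so the odd part keeps the residue that it has
  in \<open>4! = 8 \<cdot> 3\<close>.\<close>

lemma fact_power_2:
  assumes "k \<ge> 2"
  shows "\<exists>u. [u = 3] (mod 4) \<and> fact (2 ^ k) * 2 = 2 ^ 2 ^ k * (u :: nat)"
  using assms
proof (induction k rule: dec_induct)
  case base
  show ?case
    by (intro exI[of _ 3]) (simp add: fact_numeral)
next
  case (step k)
  then obtain u where u: "[u = 3] (mod 4)" "fact (2 ^ k) * 2 = 2 ^ 2 ^ k * (u :: nat)"
    by blast
  obtain i where "k = 2 + i"
    using \<open>2 \<le> k\<close> le_Suc_ex by blast
  then have "[odd_prod (2 ^ k) = 1] (mod 4)"
    using odd_prod_mod_4[of "2 ^ i" 0] by (simp add: power_add)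
  then have "[u * odd_prod (2 ^ k) = 3 * 1] (mod 4)"
    by (rule cong_mult[OF u(1)])
  moreover have "fact (2 ^ Suc k) * 2 = 2 ^ 2 ^ k * (fact (2 ^ k) * 2) * odd_prod (2 ^ k)"
    by (simp add: fact_double)
  then have "fact (2 ^ Suc k) * 2 = 2 ^ 2 ^ Suc k * (u * odd_prod (2 ^ k))"
    by (simp add: u(2) mult_2 power_add)
  ultimately show ?case
    by auto
qed

section \<open>The 4-Catalan numbers\<close>

text \<open>Two halvings turn \<open>(4 n)!\<close> into \<open>2\<^bsup>3 n\<^esup> n!\<close> times two odd products. The \<open>n!\<close> cancels against
  the one in the denominator of the binomial coefficient, and the factor \<open>3 n + 1\<close> completes
  \<open>(3 n)!\<close> to \<open>(3 n + 1)!\<close>.\<close>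

lemma s_catalan_4_fact:
  "s_catalan 4 n * fact (3 * n + 1) = 2 ^ (3 * n) * (odd_prod (2 * n) * odd_prod n)"
proof -
  have "fact n * (s_catalan 4 n * fact (3 * n + 1)) =
      s_catalan 4 n * (3 * n + 1) * (fact n * fact (3 * n))"
    by (simp add: algebra_simps)
  also have "s_catalan 4 n * (3 * n + 1) = 4 * n choose n"
    using dvd_div_mult_self[OF s_catalan_dvd[of 4 n]]
    by (simp add: s_catalan_def del: mult_Suc_right)
  also have "(4 * n choose n) * (fact n * fact (3 * n)) = fact (4 * n)"
    using binomial_fact_lemma[of n "4 * n"] by (simp add: mult_ac)
  also have "\<dots> = fact n * (2 ^ (3 * n) * (odd_prod (2 * n) * odd_prod n))"
    using fact_double[of "2 * n"] fact_double[of n] power_add[of "2::nat" "2 * n" n]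
    by (simp add: mult_ac)
  finally show ?thesis
    by simp
qed

text \<open>The exponent of \<open>2\<close> in \<open>F(4,n)\<close> is \<open>3 n\<close> minus that in \<open>(3 n + 1)!\<close>, which Legendre's
  formula gives as \<open>3 n + 1\<close> minus the digit sum. Carrying the odd factors \<open>u\<close> and \<open>w\<close> along
  expresses this without valuations.\<close>

lemma s_catalan_4_odd_multiple:
  obtains u w where "odd u" "odd w"
    "s_catalan 4 n * u = 2 ^ (bit_sum (3 * n + 1) - 1) * w"
proof -
  obtain u :: nat where u: "odd u"
    "fact (3 * n + 1) * 2 ^ bit_sum (3 * n + 1) = 2 ^ (3 * n + 1) * u"
    using fact_bit_sum[of "3 * n + 1"] by auto
  define w where "w = odd_prod (2 * n) * odd_prod n"
  obtain b where b: "bit_sum (3 * n + 1) = Suc b"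
    using bit_sum_eq_0[of "3 * n + 1"] not0_implies_Suc by auto
  have "2 ^ (3 * n + 1) * (s_catalan 4 n * u) =
      s_catalan 4 n * fact (3 * n + 1) * 2 ^ bit_sum (3 * n + 1)"
    using u(2) by (simp only: mult_ac)
  also have "\<dots> = 2 ^ (3 * n + 1) * (2 ^ b * w)"
    unfolding s_catalan_4_fact b w_def by simp
  finally have "s_catalan 4 n * u = 2 ^ b * w"
    by simp
  moreover have "odd w"
    by (simp add: w_def odd_odd_prod)
  ultimately show thesis
    using that u(1) b by simp
qed

text \<open>Knowing that \<open>F(4,n)\<close> is odd does not decide between \<open>1\<close> and \<open>3\<close> modulo \<open>4\<close>. For \<open>t > 0\<close>
  the odd part \<open>u\<close> of \<open>(3 n + 1)!\<close> and the odd part of \<open>(4 n)! / n!\<close> are both \<open>3\<close>, which is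
  invertible.\<close>

lemma s_catalan_4_cong_1:
  assumes "3 * n + 1 = 2 ^ (2 * t)"
  shows "[s_catalan 4 n = 1] (mod 4)"
proof (cases "t = 0")
  case True
  have "n = 0"
    using assms unfolding True by simp
  then show ?thesis
    by (simp add: s_catalan_def)
next
  case False
  then have "2 \<le> 2 * t"
    by simp
  from fact_power_2[OF this, folded assms] obtain u :: nat
    where u: "[u = 3] (mod 4)" "fact (3 * n + 1) * 2 = 2 ^ (3 * n + 1) * u"
    by blast
  have "2 ^ (3 * n + 1) * (s_catalan 4 n * u) = s_catalan 4 n * fact (3 * n + 1) * 2"
    unfolding mult.assoc u(2) by (simp only: mult_ac)
  also have "\<dots> = 2 ^ (3 * n + 1) * (odd_prod (2 * n) * odd_prod n)"
    unfolding s_catalan_4_fact by simp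
  finally have *: "s_catalan 4 n * u = odd_prod (2 * n) * odd_prod n"
    by simp
  have "4 dvd 3 * n + 1"
    using le_imp_power_dvd[OF \<open>2 \<le> 2 * t\<close>, of "2::nat"] unfolding assms by simp
  then have "n = 4 * (n div 4) + 1"
    by presburger
  then obtain q where q: "n = 4 * q + 1" ..
  have small: "odd_prod 1 = 1" "odd_prod 2 = 3"
    by (simp_all add: odd_prod_def numeral_2_eq_2)
  have "[odd_prod n = 1] (mod 4)"
    using odd_prod_mod_4[of q 1] unfolding q small .
  moreover have "2 * n = 4 * (2 * q) + 2"
    by (simp add: q)
  then have "[odd_prod (2 * n) = 3] (mod 4)"
    using odd_prod_mod_4[of "2 * q" 2] by (simp only: small)
  ultimately have "[s_catalan 4 n * u = 3 * 1] (mod 4)"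
    unfolding * by (intro cong_mult)
  moreover have "[s_catalan 4 n * u = s_catalan 4 n * 3] (mod 4)"
    using u(1) by (intro cong_mult cong_refl)
  ultimately have "[s_catalan 4 n * 3 = 1 * 3] (mod 4)"
    by (metis cong_sym cong_trans mult.commute)
  moreover have "coprime (3::nat) 4"
    using coprime_Suc_right_nat[of 3] by simp
  ultimately show ?thesis
    using cong_mult_rcancel_nat by blast
qed

lemma s_catalan_4_cong_2:
  assumes "bit_sum (3 * n + 1) = 2"
  shows "[s_catalan 4 n = 2] (mod 4)"
proof -
  obtain u w where uw: "odd u" "odd w" "s_catalan 4 n * u = 2 * w"
    using s_catalan_4_odd_multiple[of n] assms by auto
  then have "even (s_catalan 4 n)"
    by (metis dvd_triv_left even_mult_iff)
  then obtain c where c: "s_catalan 4 n = 2 * c" ..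
  then have "c * u = w"
    using uw(3) by simp
  then have "odd c"
    using uw(2) by auto
  then show ?thesis
    unfolding c cong_def by presburger
qed

lemma four_dvd_s_catalan_4:
  assumes "bit_sum (3 * n + 1) \<ge> 3"
  shows "4 dvd s_catalan 4 n"
proof -
  obtain u w where uw: "odd u" "s_catalan 4 n * u = 2 ^ (bit_sum (3 * n + 1) - 1) * w"
    using s_catalan_4_odd_multiple[of n] by blast
  have "2\<^sup>2 dvd (2::nat) ^ (bit_sum (3 * n + 1) - 1)"
    using assms by (intro le_imp_power_dvd) simp
  then have "2\<^sup>2 dvd s_catalan 4 n * u"
    unfolding uw(2) by (rule dvd_mult2)
  moreover have "coprime (2\<^sup>2) u"
    using uw(1) coprime_left_2_iff_odd coprime_power_left_iff by blast
  ultimately have "2\<^sup>2 dvd s_catalan 4 n"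
    by (simp only: coprime_dvd_mult_left_iff)
  then show ?thesis
    by simp
qed

lemma power_2_mod_3: "(2::nat) ^ a mod 3 = (if even a then 1 else 2)"
proof (induction a)
  case (Suc a)
  have "(2::nat) ^ Suc a mod 3 = 2 * (2 ^ a mod 3) mod 3"
    by (simp add: mod_mult_right_eq)
  then show ?case
    using Suc.IH by simp
qed simp

lemma bit_sum_eq_1_iff:
  "bit_sum (3 * n + 1) = 1 \<longleftrightarrow> (\<exists>t. 3 * n + 1 = 2 ^ (2 * t))"
proof
  assume "bit_sum (3 * n + 1) = 1"
  then obtain a where a: "3 * n + 1 = 2 ^ a"
    using bit_sum_eq_1D by blast
  have "(if even a then 1 else 2) = (3 * n + 1) mod 3"
    unfolding a by (rule power_2_mod_3[symmetric])
  also have "\<dots> = 1"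
    by simp
  finally have "even a"
    by (simp split: if_splits)
  then show "\<exists>t. 3 * n + 1 = 2 ^ (2 * t)"
    using a by auto
qed (metis bit_sum_power)

lemma bit_sum_eq_2_iff:
  "bit_sum (3 * n + 1) = 2 \<longleftrightarrow>
    (\<exists>t j. t > j \<and> 3 * n + 1 = 2 ^ (2 * t + 1) + 2 ^ (2 * j + 1))"
proof
  assume "bit_sum (3 * n + 1) = 2"
  then obtain a b where ab: "b < a" "3 * n + 1 = 2 ^ a + 2 ^ b"
    using bit_sum_eq_2D by blast
  have "(2 ^ a mod 3 + 2 ^ b mod 3) mod 3 = (3 * n + 1) mod 3"
    unfolding ab(2) by (rule mod_add_eq)
  also have "\<dots> = 1"
    by simp
  finally have "odd a" "odd b"
    unfolding power_2_mod_3 by (auto split: if_splits)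
  then obtain t j where "a = 2 * t + 1" "b = 2 * j + 1"
    by (elim oddE)
  then show "\<exists>t j. t > j \<and> 3 * n + 1 = 2 ^ (2 * t + 1) + 2 ^ (2 * j + 1)"
    using ab by auto
next
  assume "\<exists>t j. t > j \<and> 3 * n + 1 = 2 ^ (2 * t + 1) + 2 ^ (2 * j + 1)"
  then obtain t j where "t > j" "3 * n + 1 = 2 ^ (2 * t + 1) + 2 ^ (2 * j + 1)"
    by blast
  then show "bit_sum (3 * n + 1) = 2"
    using bit_sum_two_powers[of "2 * j + 1" "2 * t + 1"] by simp
qed

lemma real_eq_third_iff:
  fixes n m :: nat
  shows "real n = (real m - 1) / 3 \<longleftrightarrow> 3 * n + 1 = m"
proof -
  have "real n = (real m - 1) / 3 \<longleftrightarrow> real (3 * n + 1) = real m"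
    by (auto simp: field_simps)
  then show ?thesis
    by (simp only: of_nat_eq_iff)
qed

theorem corollary7:
  fixes n :: nat
  shows "((\<exists>t::nat. real n = (2 ^ (2 * t) - 1) / 3) \<longrightarrow> [s_catalan 4 n = 1] (mod 4)) \<and>
    ((\<exists>t j::nat. t > j \<and> real n = (2 ^ (2 * t + 1) + 2 ^ (2 * j + 1) - 1) / 3) \<longrightarrow>
      [s_catalan 4 n = 2] (mod 4)) \<and>
    (\<not> (\<exists>t::nat. real n = (2 ^ (2 * t) - 1) / 3) \<and>
     \<not> (\<exists>t j::nat. t > j \<and> real n = (2 ^ (2 * t + 1) + 2 ^ (2 * j + 1) - 1) / 3) \<longrightarrow>
      4 dvd s_catalan 4 n)"
proof -
  have one: "real n = (2 ^ (2 * t) - 1) / 3 \<longleftrightarrow> 3 * n + 1 = 2 ^ (2 * t)" for t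
    using real_eq_third_iff[of n "2 ^ (2 * t)"] by simp
  have two: "real n = (2 ^ (2 * t + 1) + 2 ^ (2 * j + 1) - 1) / 3 \<longleftrightarrow>
      3 * n + 1 = 2 ^ (2 * t + 1) + 2 ^ (2 * j + 1)" for t j
    using real_eq_third_iff[of n "2 ^ (2 * t + 1) + 2 ^ (2 * j + 1)"] by simp
  have "bit_sum (3 * n + 1) \<ge> 3" if "bit_sum (3 * n + 1) \<noteq> 1" "bit_sum (3 * n + 1) \<noteq> 2"
    using that bit_sum_eq_0[of "3 * n + 1"] by linarith
  then show ?thesis
    unfolding one two
    using s_catalan_4_cong_1[of n] s_catalan_4_cong_2[of n] four_dvd_s_catalan_4[of n]
      bit_sum_eq_1_iff[of n] bit_sum_eq_2_iff[of n] by blast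
qed

end
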